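(* Let $k\in\mathbb{N}$, let $(X,f_{1,\infty})$ be a $k$-periodic non-autonomous discrete system and let $g=f_k\circ f_{k-1}\circ\cdots\circ f_1$. If the autonomous discrete system $(X,g)$ is syndetically sensitive (respectively, ergodically sensitive), then $(X,f_{1,\infty})$ is syndetically sensitive (respectively, ergodically sensitive). Conversely, if each $f_p$ $(p=1,2,\dots,k)$ is uniformly continuous and $(X,f_{1,\infty})$ is syndetically sensitive (respectively, ergodically sensitive), then $(X,g)$ is syndetically sensitive (respectively, ergodically sensitive).
   Context: $\mathbb{N}=\{1,2,3,\dots\}$, $\mathbb{Z}_+=\{0,1,2,\dots\}$. A non-autonomous discrete system (NDS) $(X,f_{1,\infty})$ consists of a metric space $(X,d)$ and a sequence $f_{1,\infty}=(f_n)_{n=1}^\infty$ of continuous maps $f_n:X\to X$. For $i,n\in\mathbb{N}$, $f_i^n:=f_{i+n-1}\circ\cdots\circ f_i$. The NDS is $k$-periodic if $f_{n+k}=f_n$ for all $n\in\mathbb{N}$. An autonomous system $(X,g)$ is the special case $f_n=g$ for all $n$ (so $f_1^n$ is the $n$-th iterate $g^n$). For a non-empty open set $U\subseteq X$ and $\delta>0$, $N_{f_{1,\infty}}(U,\delta)=\{n\in\mathbb{N}:\text{there exist }x,y\in U\text{ with }d(f_1^n(x),f_1^n(y))>\delta\}$. Syndetic: $A\subseteq\mathbb{Z}_+$ is syndetic if there is a positive integer $M$ with $\{i,i+1,\dots,i+M\}\cap A\neq\emptyset$ for every $i\in\mathbb{Z}_+$. Upper density: $\bar d(A)=\limsup_{n\to\infty}\frac{1}{n}\#(A\cap\{0,1,\dots,n-1\})$.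 Syndetically sensitive (respectively, ergodically sensitive): there is $\delta>0$ such that for every non-empty open set $U\subseteq X$, $N_{f_{1,\infty}}(U,\delta)$ is syndetic (respectively, has positive upper density). *)

theory Defs
  imports "HOL-Analysis.Analysis"
begin

text \<open>
  The metric space is the whole carrier of a type of class \<open>metric_space\<close>.
  The sequence of maps is indexed from 1: the value of \<open>f\<close> at 0 is junk and
  is neither used nor constrained anywhere.
\<close>

definition nds :: "(nat \<Rightarrow> 'a::metric_space \<Rightarrow> 'a) \<Rightarrow> bool" where
  "nds f \<longleftrightarrow> (\<forall>n\<ge>1. continuous_on UNIV (f n))"

definition nds_periodic :: "nat \<Rightarrow> (nat \<Rightarrow> 'a \<Rightarrow> 'a) \<Rightarrow> bool" where
  "nds_periodic k f \<longleftrightarrow> (\<forall>n\<ge>1. f (n + k) = f n)"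

text \<open>\<open>nds_comp f i n\<close> is \<open>f (i + n - 1) \<circ> \<dots> \<circ> f i\<close>, with \<open>n\<close> factors.\<close>

primrec nds_comp :: "(nat \<Rightarrow> 'a \<Rightarrow> 'a) \<Rightarrow> nat \<Rightarrow> nat \<Rightarrow> 'a \<Rightarrow> 'a" where
  "nds_comp f i 0 = id"
| "nds_comp f i (Suc n) = f (i + n) \<circ> nds_comp f i n"

text \<open>An autonomous system is the constant sequence of maps.\<close>

definition autonomous :: "('a \<Rightarrow> 'a) \<Rightarrow> nat \<Rightarrow> 'a \<Rightarrow> 'a" where
  "autonomous g = (\<lambda>n. g)"

lemma nds_comp_autonomous: "nds_comp (autonomous g) i n = g ^^ n"
  by (induction n) (simp_all add: autonomous_def)

definition separation_times ::
    "(nat \<Rightarrow> 'a::metric_space \<Rightarrow> 'a) \<Rightarrow> 'a set \<Rightarrow> real \<Rightarrow> nat set" where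
  "separation_times f U \<delta> =
     {n. n \<ge> 1 \<and> (\<exists>x\<in>U. \<exists>y\<in>U. dist (nds_comp f 1 n x) (nds_comp f 1 n y) > \<delta>)}"

definition syndetic :: "nat set \<Rightarrow> bool" where
  "syndetic A \<longleftrightarrow> (\<exists>M\<ge>1. \<forall>i. {i..i + M} \<inter> A \<noteq> {})"

definition upper_density :: "nat set \<Rightarrow> ereal" where
  "upper_density A = limsup (\<lambda>n. ereal (real (card (A \<inter> {..<n})) / real n))"

definition syndetically_sensitive :: "(nat \<Rightarrow> 'a::metric_space \<Rightarrow> 'a) \<Rightarrow> bool" where
  "syndetically_sensitive f \<longleftrightarrow>
     (\<exists>\<delta>>0. \<forall>U. open U \<and> U \<noteq> {} \<longrightarrow> syndetic (separation_times f U \<delta>))"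

definition ergodically_sensitive :: "(nat \<Rightarrow> 'a::metric_space \<Rightarrow> 'a) \<Rightarrow> bool" where
  "ergodically_sensitive f \<longleftrightarrow>
     (\<exists>\<delta>>0. \<forall>U. open U \<and> U \<noteq> {} \<longrightarrow> upper_density (separation_times f U \<delta>) > 0)"

end

theory Submission
  imports Defs
begin

text \<open>
  By periodicity the \<open>f\<close>-orbit at time \<open>k * q + r\<close> is \<open>nds_comp f 1 r\<close> applied to the
  \<open>g\<close>-orbit at time \<open>q\<close>. Hence multiplication by \<open>k\<close> sends separation times of \<open>g\<close> to
  separation times of \<open>f\<close>. Conversely, the finitely many maps \<open>nds_comp f 1 r\<close> with \<open>r < k\<close>
  share a modulus of uniform continuity, so \<open>n div k\<close> is a separation time of \<open>g\<close>, with a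
  smaller constant, for every separation time \<open>n \<ge> k\<close> of \<open>f\<close>. Both correspondences preserve
  syndeticity and positivity of the upper density.
\<close>

section \<open>Compositions along a periodic sequence\<close>

lemma nds_comp_add: "nds_comp f i (m + n) = nds_comp f (i + m) n \<circ> nds_comp f i m"
  by (induction n) (simp_all add: add.assoc comp_assoc)

lemma nds_periodic_mult:
  assumes "nds_periodic k f" "n \<ge> 1"
  shows "f (n + k * q) = f n"
proof (induction q)
  case (Suc q)
  have "f (n + k * Suc q) = f ((n + k * q) + k)"
    by (simp add: algebra_simps)
  also have "\<dots> = f (n + k * q)"
    using assms unfolding nds_periodic_def by (meson trans_le_add1)
  finally show ?case using Suc by simp
qed simp

lemma nds_comp_shift_period:
  assumes "nds_periodic k f" "i \<ge> 1"
  shows "nds_comp f (i + k * q) r = nds_comp f i r"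
proof (induction r)
  case (Suc r)
  have "f (i + k * q + r) = f (i + r)"
    using nds_periodic_mult[OF assms(1), of "i + r" q] assms(2) by (simp add: algebra_simps)
  then show ?case using Suc by simp
qed simp

text \<open>The first \<open>k * q\<close> maps split into \<open>q\<close> blocks of length
  \<open>k\<close>, each composing to the same map by periodicity. The remaining \<open>r\<close>
  maps start at index \<open>1 + k * q\<close>, which periodicity moves back to 1.\<close>

lemma nds_comp_periodic:
  assumes "nds_periodic k f"
  shows "nds_comp f 1 (k * q + r) = nds_comp f 1 r \<circ> nds_comp f 1 k ^^ q"
proof -
  have "nds_comp f 1 (k * q) = nds_comp f 1 k ^^ q"
  proof (induction q)
    case (Suc q)
    have "nds_comp f 1 (k * Suc q) = nds_comp f (1 + k * q) k \<circ> nds_comp f 1 (k * q)"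
      by (simp only: mult_Suc_right add.commute[of k] nds_comp_add)
    then show ?case using Suc nds_comp_shift_period[OF assms, of 1 q k] by simp
  qed simp
  then show ?thesis
    using nds_comp_add[of f 1 "k * q" r] nds_comp_shift_period[OF assms, of 1 q r] by simp
qed

section \<open>Uniform continuity of compositions and of finite families\<close>

lemma uniformly_continuous_on_nds_comp:
  fixes f :: "nat \<Rightarrow> 'a::metric_space \<Rightarrow> 'a"
  assumes "\<And>j. j < n \<Longrightarrow> uniformly_continuous_on UNIV (f (i + j))"
  shows "uniformly_continuous_on UNIV (nds_comp f i n)"
  using assms
proof (induction n)
  case 0
  then show ?case by (simp add: id_def uniformly_continuous_on_id)
next
  case (Suc n)
  then have "uniformly_continuous_on UNIV (nds_comp f i n)" by simp
  moreover have "uniformly_continuous_on (range (nds_comp f i n)) (f (i + n))"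
    using Suc.prems[of n] unfolding uniformly_continuous_on_def by (meson UNIV_I lessI)
  ultimately show ?case
    unfolding nds_comp.simps by (rule uniformly_continuous_on_compose[unfolded o_def[symmetric]])
qed

text \<open>Finiteness of \<open>I\<close> keeps the minimum of the individual moduli positive. The
  family intended is that of the remainders \<open>r < k\<close>.\<close>

lemma uniformly_continuous_on_common_modulus:
  fixes h :: "'i \<Rightarrow> 'a::metric_space \<Rightarrow> 'b::metric_space"
  assumes "finite I" and "\<And>i. i \<in> I \<Longrightarrow> uniformly_continuous_on S (h i)" and "\<epsilon> > 0"
  obtains d where "d > 0"
    "\<And>i x y. i \<in> I \<Longrightarrow> x \<in> S \<Longrightarrow> y \<in> S \<Longrightarrow> dist x y < d \<Longrightarrow> dist (h i x) (h i y) < \<epsilon>"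
proof -
  have "\<exists>d>0. \<forall>i\<in>I. \<forall>x\<in>S. \<forall>y\<in>S. dist x y < d \<longrightarrow> dist (h i x) (h i y) < \<epsilon>"
    using assms(1,2)
  proof (induction I)
    case empty
    show ?case by (auto intro: exI[of _ 1])
  next
    case (insert i I)
    then obtain d where d: "d > 0"
      "\<forall>i\<in>I. \<forall>x\<in>S. \<forall>y\<in>S. dist x y < d \<longrightarrow> dist (h i x) (h i y) < \<epsilon>" by auto
    have "uniformly_continuous_on S (h i)" using insert.prems by simp
    then obtain e where "e > 0"
      "\<forall>x\<in>S. \<forall>y\<in>S. dist x y < e \<longrightarrow> dist (h i x) (h i y) < \<epsilon>"
      using \<open>\<epsilon> > 0\<close> unfolding uniformly_continuous_on_def by metis
    with d show ?case by (intro exI[of _ "min d e"]) auto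
  qed
  then show ?thesis using that by blast
qed

section \<open>Syndeticity and upper density under multiplication and division by
  \<open>k\<close>\<close>

lemma syndetic_if_mult:
  assumes "k \<ge> 1" and mult: "\<And>n. n \<in> A \<Longrightarrow> k * n \<in> B" and "syndetic A"
  shows "syndetic B"
proof -
  obtain M where M: "\<And>i. {i..i + M} \<inter> A \<noteq> {}"
    using \<open>syndetic A\<close> unfolding syndetic_def by blast
  \<comment> \<open>Reaching the first multiple of \<open>k\<close> beyond \<open>i\<close> costs at
    most \<open>k\<close>, and a window of length \<open>M\<close> for \<open>A\<close> becomes one
    of length \<open>k * M\<close>.\<close>
  have "{i..i + k * (M + 1)} \<inter> B \<noteq> {}" for i
  proof -
    let ?q = "i div k"
    obtain n where n: "?q + 1 \<le> n" "n \<le> ?q + 1 + M" "n \<in> A"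
      using M[of "?q + 1"] by auto
    have "i < k * (?q + 1)"
      using \<open>k \<ge> 1\<close> by (simp add: dividend_less_times_div)
    then have "i \<le> k * n"
      using mult_le_mono2[OF n(1), of k] by linarith
    moreover have "k * n \<le> k * ?q + k * (M + 1)"
      using mult_le_mono2[OF n(2), of k] by (simp add: algebra_simps)
    then have "k * n \<le> i + k * (M + 1)"
      using times_div_less_eq_dividend[of k i] by linarith
    ultimately show ?thesis using mult[OF n(3)] by auto
  qed
  moreover have "k * (M + 1) \<ge> 1" using \<open>k \<ge> 1\<close> by simp
  ultimately show ?thesis unfolding syndetic_def by blast
qed

text \<open>Division by \<open>k\<close> does not lengthen gaps. The restriction
  \<open>n \<ge> k\<close> suits the application: smaller \<open>n\<close> have quotient 0, which is
  never a separation time.\<close>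

lemma syndetic_if_div:
  assumes "k \<ge> 1" and div: "\<And>n. n \<in> B \<Longrightarrow> n \<ge> k \<Longrightarrow> n div k \<in> A" and "syndetic B"
  shows "syndetic A"
proof -
  obtain M where "M \<ge> 1" and M: "\<And>i. {i..i + M} \<inter> B \<noteq> {}"
    using \<open>syndetic B\<close> unfolding syndetic_def by blast
  have "{i..i + (M + 1)} \<inter> A \<noteq> {}" for i
  proof -
    \<comment> \<open>Starting at \<open>k * (i + 1)\<close> instead of \<open>k * i\<close> forces
      \<open>n \<ge> k\<close> even for \<open>i = 0\<close>; this shift is why the window for
      \<open>A\<close> has length \<open>M + 1\<close>.\<close>
    obtain n where n: "k * (i + 1) \<le> n" "n \<le> k * (i + 1) + M" "n \<in> B"
      using M[of "k * (i + 1)"] by auto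
    have "k \<le> n" using n(1) by simp
    moreover have "i + 1 \<le> n div k"
      using div_le_mono[OF n(1), of k] \<open>k \<ge> 1\<close> by simp
    moreover have "n \<le> M + k * (i + 1)" using n(2) by simp
    then have "n div k \<le> M div k + (i + 1)"
      using div_le_mono[of n "M + k * (i + 1)" k] \<open>k \<ge> 1\<close>
      by (metis div_mult_self2 not_one_le_zero add.commute)
    then have "n div k \<le> i + (M + 1)"
      using div_le_dividend[of M k] by linarith
    ultimately have "n div k \<in> {i..i + (M + 1)} \<inter> A" using div[OF n(3)] by simp
    then show ?thesis by blast
  qed
  then show ?thesis unfolding syndetic_def by (metis le_add2)
qed

text \<open>Trades the limsup for a linear lower bound on the counting function at arbitrarily large
  \<open>n\<close>, so that the transfer of positivity becomes plain counting.\<close>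

lemma upper_density_pos_iff:
  "upper_density A > 0 \<longleftrightarrow>
     (\<exists>c>0. \<forall>N. \<exists>n\<ge>N. c * real n \<le> real (card (A \<inter> {..<n})))" (is "_ \<longleftrightarrow> ?R")
proof
  let ?X = "\<lambda>n. ereal (real (card (A \<inter> {..<n})) / real n)"
  assume "upper_density A > 0"
  then obtain c where c: "0 < ereal c" "ereal c < limsup ?X"
    unfolding upper_density_def using ereal_dense2 by blast
  then have "\<not> (\<forall>\<^sub>F n in sequentially. ?X n \<le> ereal c)"
    using Limsup_bounded[of ?X "ereal c" sequentially] leD by metis
  then have "\<exists>\<^sub>F n in sequentially. ereal c < ?X n"
    by (simp only: not_eventually not_le)
  have "\<exists>n\<ge>N. c * real n \<le> real (card (A \<inter> {..<n}))" for N
  proof -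
    obtain n where "n \<ge> Suc N" "ereal c < ?X n"
      using \<open>\<exists>\<^sub>F n in sequentially. ereal c < ?X n\<close> unfolding frequently_sequentially by blast
    then show ?thesis by (intro exI[of _ n]) (auto simp: field_simps)
  qed
  with c show ?R by auto
next
  let ?X = "\<lambda>n. ereal (real (card (A \<inter> {..<n})) / real n)"
  assume ?R
  then obtain c where c: "c > 0"
    "\<And>N. \<exists>n\<ge>N. c * real n \<le> real (card (A \<inter> {..<n}))" by blast
  have "\<exists>\<^sub>F n in sequentially. ereal c \<le> ?X n"
    unfolding frequently_sequentially
  proof
    fix N
    \<comment> \<open>\<open>Suc N\<close> excludes \<open>n = 0\<close>, where the linear bound
      holds trivially but the quotient is 0 by default.\<close>
    obtain n where "n \<ge> Suc N" "c * real n \<le> real (card (A \<inter> {..<n}))"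
      using c(2) by blast
    then show "\<exists>n\<ge>N. ereal c \<le> ?X n" by (intro exI[of _ n]) (auto simp: field_simps)
  qed
  then have "\<not> (\<forall>\<^sub>F n in sequentially. ?X n < ereal c)"
    by (simp only: not_eventually not_less)
  then have "ereal c \<le> limsup ?X"
    using Limsup_lessD[of sequentially ?X "ereal c"] by (metis not_le)
  with c(1) show "upper_density A > 0"
    unfolding upper_density_def by (metis ereal_less(2) less_le_trans)
qed

text \<open>Multiplication by \<open>k\<close> injects the part of \<open>A\<close> below
  \<open>n\<close> into the part of \<open>B\<close> below \<open>k * n\<close>, so a constant
  \<open>c\<close> for \<open>A\<close> gives \<open>c / k\<close> for \<open>B\<close>.\<close>

lemma upper_density_pos_if_mult:
  assumes "k \<ge> 1" and mult: "\<And>n. n \<in> A \<Longrightarrow> k * n \<in> B" and "upper_density A > 0"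
  shows "upper_density B > 0"
proof -
  obtain c where "c > 0" and c: "\<And>N. \<exists>n\<ge>N. c * real n \<le> real (card (A \<inter> {..<n}))"
    using assms(3) unfolding upper_density_pos_iff by blast
  have "\<exists>m\<ge>N. c / k * real m \<le> real (card (B \<inter> {..<m}))" for N
  proof -
    obtain n where n: "n \<ge> N" "c * real n \<le> real (card (A \<inter> {..<n}))" using c by blast
    have "card (A \<inter> {..<n}) \<le> card (B \<inter> {..<k * n})"
      using \<open>k \<ge> 1\<close> mult by (intro card_inj_on_le[of "(*) k"]) (auto simp: inj_on_def)
    then have "c / k * real (k * n) \<le> real (card (B \<inter> {..<k * n}))"
      using n(2) \<open>k \<ge> 1\<close> by simp
    moreover have "k * n \<ge> N"
      using mult_le_mono[OF \<open>k \<ge> 1\<close> n(1)] by simp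
    ultimately show ?thesis by blast
  qed
  moreover have "c / k > 0" using \<open>c > 0\<close> \<open>k \<ge> 1\<close> by simp
  ultimately show ?thesis unfolding upper_density_pos_iff by blast
qed

text \<open>At most \<open>k\<close> numbers share a quotient, so \<open>B\<close> outnumbers
  \<open>A\<close> below any bound by at most a factor \<open>k\<close>, up to the fewer than
  \<open>k + 1\<close> elements below \<open>k\<close>.\<close>

lemma upper_density_pos_if_div:
  assumes "k \<ge> 1" and div: "\<And>n. n \<in> B \<Longrightarrow> n \<ge> k \<Longrightarrow> n div k \<in> A" and "upper_density B > 0"
  shows "upper_density A > 0"
proof -
  obtain c where "c > 0" and c: "\<And>N. \<exists>n\<ge>N. c * real n \<le> real (card (B \<inter> {..<n}))"
    using assms(3) unfolding upper_density_pos_iff by blast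
  have card_le: "card (B \<inter> {..<m}) \<le> k + card (A \<inter> {..<m}) * k" for m
  proof -
    let ?S = "(A \<inter> {..<m}) \<times> {..<k}"
    \<comment> \<open>Division with remainder recovers \<open>n\<close> from its pair, and
      \<open>n div k \<le> n < m\<close> keeps the quotient below the same bound.\<close>
    have "B \<inter> {..<m} \<subseteq> {..<k} \<union> (\<lambda>(q, r). k * q + r) ` ?S"
    proof
      fix n assume n: "n \<in> B \<inter> {..<m}"
      show "n \<in> {..<k} \<union> (\<lambda>(q, r). k * q + r) ` ?S"
      proof (cases "n < k")
        case False
        then have "(n div k, n mod k) \<in> ?S"
          using n div[of n] \<open>k \<ge> 1\<close> le_less_trans[OF div_le_dividend, of n m k] by auto
        then show ?thesis by (intro UnI2 rev_image_eqI) auto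
      qed simp
    qed
    then have "card (B \<inter> {..<m}) \<le> card ({..<k} \<union> (\<lambda>(q, r). k * q + r) ` ?S)"
      by (intro card_mono) auto
    also have "\<dots> \<le> card {..<k} + card ?S"
      by (intro order.trans[OF card_Un_le] add_left_mono card_image_le) simp
    finally show ?thesis by (simp add: card_cartesian_product)
  qed
  have "\<exists>m\<ge>N. c / (2 * k) * real m \<le> real (card (A \<inter> {..<m}))" for N
  proof -
    \<comment> \<open>The threshold \<open>2 * k / c\<close> makes the additive error
      \<open>k\<close> at most half of \<open>c * real m\<close>; the other half yields the constant
      \<open>c / (2 * k)\<close>.\<close>
    obtain m where m: "m \<ge> max N (nat \<lceil>2 * k / c\<rceil>)" "c * real m \<le> real (card (B \<inter> {..<m}))"
      using c by blast
    have "2 * k / c \<le> real m" using m(1) by linarith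
    then have "2 * k \<le> c * real m" using \<open>c > 0\<close> by (simp add: field_simps)
    moreover have "c * real m \<le> k + real (card (A \<inter> {..<m})) * k"
      using m(2) of_nat_mono[OF card_le[of m], where 'a = real] by simp
    ultimately have "c * real m \<le> 2 * (real (card (A \<inter> {..<m})) * k)" by simp
    then have "c / (2 * k) * real m \<le> real (card (A \<inter> {..<m}))"
      using \<open>k \<ge> 1\<close> by (simp add: field_simps)
    then show ?thesis using m(1) by auto
  qed
  moreover have "c / (2 * k) > 0" using \<open>c > 0\<close> \<open>k \<ge> 1\<close> by simp
  ultimately show ?thesis unfolding upper_density_pos_iff by blast
qed

section \<open>Transfer of separation times\<close>

text \<open>This is remainder 0: time \<open>k * n\<close> for \<open>f\<close> is the
  \<open>n\<close>-th iterate of \<open>nds_comp f 1 k\<close>, so \<open>\<delta>\<close> is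
  unchanged.\<close>

lemma separation_times_mult:
  assumes "k \<ge> 1" "nds_periodic k f" "n \<in> separation_times (autonomous (nds_comp f 1 k)) U \<delta>"
  shows "k * n \<in> separation_times f U \<delta>"
  using assms nds_comp_periodic[OF assms(2), of n 0]
  by (auto simp: separation_times_def nds_comp_autonomous)

text \<open>By contraposition: two points close after \<open>n div k\<close> blocks stay within
  \<open>\<delta>\<close> under the remaining \<open>n mod k\<close> maps. The constant
  \<open>\<eta>\<close> is chosen before \<open>U\<close> and \<open>n\<close>, as sensitivity
  demands.\<close>

lemma separation_times_div:
  assumes "k \<ge> 1" "nds_periodic k f"
    and uc: "\<forall>p\<in>{1..k}. uniformly_continuous_on UNIV (f p)" and "\<delta> > 0"
  obtains \<eta> where "\<eta> > 0"
    "\<And>U n. n \<in> separation_times f U \<delta> \<Longrightarrow> n \<ge> k \<Longrightarrow>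
       n div k \<in> separation_times (autonomous (nds_comp f 1 k)) U \<eta>"
proof -
  have "uniformly_continuous_on UNIV (nds_comp f 1 r)" if "r \<in> {..<k}" for r
    using uc that by (intro uniformly_continuous_on_nds_comp) auto
  then obtain d where "d > 0" and
    d: "\<And>r x y. r < k \<Longrightarrow> dist x y < d \<Longrightarrow> dist (nds_comp f 1 r x) (nds_comp f 1 r y) < \<delta>"
    using uniformly_continuous_on_common_modulus[of "{..<k}" UNIV "nds_comp f 1" \<delta>] \<open>\<delta> > 0\<close>
    by (metis UNIV_I finite_lessThan lessThan_iff)
  \<comment> \<open>Contraposition gives only distance at least \<open>d\<close>; halving restores
    the strict inequality.\<close>
  have "n div k \<in> separation_times (autonomous (nds_comp f 1 k)) U (d / 2)"
    if n: "n \<in> separation_times f U \<delta>" "n \<ge> k" for U n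
  proof -
    let ?G = "nds_comp f 1 k ^^ (n div k)"
    obtain x y where xy: "x \<in> U" "y \<in> U" "dist (nds_comp f 1 n x) (nds_comp f 1 n y) > \<delta>"
      using n(1) unfolding separation_times_def by blast
    have "nds_comp f 1 n = nds_comp f 1 (n mod k) \<circ> ?G"
      using nds_comp_periodic[OF assms(2), of "n div k" "n mod k"] by simp
    then have "\<not> dist (?G x) (?G y) < d"
      using d[of "n mod k" "?G x" "?G y"] xy(3) \<open>k \<ge> 1\<close> by auto
    then have "dist (?G x) (?G y) > d / 2" using \<open>d > 0\<close> by simp
    moreover have "n div k \<ge> 1" using div_le_mono[OF n(2), of k] \<open>k \<ge> 1\<close> by simp
    ultimately show ?thesis
      using xy(1,2) unfolding separation_times_def nds_comp_autonomous by blast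
  qed
  with \<open>d > 0\<close> show ?thesis by (intro that[of "d / 2"]) auto
qed

theorem theorem12:
  fixes f :: "nat \<Rightarrow> 'a::metric_space \<Rightarrow> 'a" and g :: "'a \<Rightarrow> 'a" and k :: nat
  assumes "k \<ge> 1"
    and "nds f"
    and "nds_periodic k f"
    and "g = nds_comp f 1 k"
  shows "(syndetically_sensitive (autonomous g) \<longrightarrow> syndetically_sensitive f) \<and>
         (ergodically_sensitive (autonomous g) \<longrightarrow> ergodically_sensitive f) \<and>
         ((\<forall>p\<in>{1..k}. uniformly_continuous_on UNIV (f p)) \<longrightarrow>
            (syndetically_sensitive f \<longrightarrow> syndetically_sensitive (autonomous g)) \<and>
            (ergodically_sensitive f \<longrightarrow> ergodically_sensitive (autonomous g)))"
proof (intro conjI impI)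
  note mult = separation_times_mult[OF assms(1,3), folded assms(4)]
  show "syndetically_sensitive f" if "syndetically_sensitive (autonomous g)"
    \<comment> \<open>The same \<open>\<delta>\<close> serves for \<open>f\<close>, with
      \<open>mult\<close> applied to each open set separately.\<close>
    using that syndetic_if_mult[OF assms(1) mult] unfolding syndetically_sensitive_def by meson
  show "ergodically_sensitive f" if "ergodically_sensitive (autonomous g)"
    using that upper_density_pos_if_mult[OF assms(1) mult]
    unfolding ergodically_sensitive_def by meson
next
  assume uc: "\<forall>p\<in>{1..k}. uniformly_continuous_on UNIV (f p)"
  note div = separation_times_div[OF assms(1,3) uc, folded assms(4)]
  show "syndetically_sensitive (autonomous g)" if sens: "syndetically_sensitive f"
  proof -
    obtain \<delta> where "\<delta> > 0"
      and \<delta>: "\<And>U. open U \<Longrightarrow> U \<noteq> {} \<Longrightarrow> syndetic (separation_times f U \<delta>)"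
      using sens unfolding syndetically_sensitive_def by blast
    obtain \<eta> where "\<eta> > 0" and \<eta>: "\<And>U n. n \<in> separation_times f U \<delta> \<Longrightarrow> n \<ge> k \<Longrightarrow>
        n div k \<in> separation_times (autonomous g) U \<eta>"
      using div[OF \<open>\<delta> > 0\<close>] by blast
    show ?thesis
      \<comment> \<open>Since \<open>\<eta>\<close> does not depend on \<open>U\<close>, it is a
        sensitivity constant for \<open>g\<close>.\<close>
      unfolding syndetically_sensitive_def
      using \<open>\<eta> > 0\<close> syndetic_if_div[OF assms(1) \<eta> \<delta>] by blast
  qed
  show "ergodically_sensitive (autonomous g)" if sens: "ergodically_sensitive f"
  proof -
    obtain \<delta> where "\<delta> > 0"
      and \<delta>: "\<And>U. open U \<Longrightarrow> U \<noteq> {} \<Longrightarrow> upper_density (separation_times f U \<delta>) > 0"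
      using sens unfolding ergodically_sensitive_def by blast
    obtain \<eta> where "\<eta> > 0" and \<eta>: "\<And>U n. n \<in> separation_times f U \<delta> \<Longrightarrow> n \<ge> k \<Longrightarrow>
        n div k \<in> separation_times (autonomous g) U \<eta>"
      using div[OF \<open>\<delta> > 0\<close>] by blast
    show ?thesis
      unfolding ergodically_sensitive_def
      using \<open>\<eta> > 0\<close> upper_density_pos_if_div[OF assms(1) \<eta> \<delta>] by blast
  qed
qed

end
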